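(* Let $d\ge2$ and let $\{Q_j\}_{j=1}^{d^2}$ be an NQPR in dimension $d$. Then its unitary negativity satisfies $$1\le N_{\mathrm U}(\{Q_j\})\le d-\frac{2}{d}.$$ The lower bound is attained if and only if there is a SIC $\{\Pi_j\}_{j=1}^{d^2}$ such that either $Q_j=Q_j^-$ for all $j$ or $Q_j=Q_j^+$ for all $j$.
   Context: An NQPR in dimension $d$ is a family $\{Q_j\}_{j=1}^{d^2}$ of Hermitian operators on $\mathbb{C}^d$ with $\operatorname{tr}(Q_j)=1$ and $\operatorname{tr}(Q_jQ_k)=d\,\delta_{jk}$. For a unitary $U$ on $\mathbb{C}^d$, define the $d^2\times d^2$ matrix $U^Q_{jk}=\operatorname{tr}(Q_jUQ_kU^\dagger)/d$ and the unitary negativity $N_{\mathrm U}(U)=-d\min_{j,k}U^Q_{jk}$; the unitary negativity $N_{\mathrm U}(\{Q_j\})$ of the NQPR is the maximum of $N_{\mathrm U}(U)$ over all unitaries $U$. A SIC in dimension $d$ is a set $\{\Pi_j\}_{j=1}^{d^2}$ of rank-one projectors with $\operatorname{tr}(\Pi_j\Pi_k)=(d\delta_{jk}+1)/(d+1)$; given a SIC, $Q_j^\pm=\mp\sqrt{d+1}\,\Pi_j+\frac{1}{d}(1\pm\sqrt{d+1})$, with $1$ the identity in the operator term. *)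

theory Defs
  imports "Jordan_Normal_Form.Matrix"
begin

text \<open>Operators on C^d are represented as d x d complex matrices (Jordan_Normal_Form).
  Families indexed by j = 1..d^2 in the paper are indexed here by j < d^2.\<close>

definition adj :: "complex mat \<Rightarrow> complex mat" where
  "adj A = mat (dim_col A) (dim_row A) (\<lambda>(i,j). cnj (A $$ (j,i)))"

definition tr :: "complex mat \<Rightarrow> complex" where
  "tr A = (\<Sum>i<dim_row A. A $$ (i,i))"

definition hermitian_op :: "nat \<Rightarrow> complex mat \<Rightarrow> bool" where
  "hermitian_op d A \<longleftrightarrow> A \<in> carrier_mat d d \<and> adj A = A"

definition unitary_op :: "nat \<Rightarrow> complex mat \<Rightarrow> bool" where
  "unitary_op d U \<longleftrightarrow> U \<in> carrier_mat d d \<and> U * adj U = 1\<^sub>m d"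

definition rank_one_projector :: "nat \<Rightarrow> complex mat \<Rightarrow> bool" where
  "rank_one_projector d P \<longleftrightarrow>
     (\<exists>v :: complex vec. dim_vec v = d \<and> (\<Sum>i<d. v $ i * cnj (v $ i)) = 1 \<and>
        P = mat d d (\<lambda>(i,j). v $ i * cnj (v $ j)))"

definition NQPR :: "nat \<Rightarrow> (nat \<Rightarrow> complex mat) \<Rightarrow> bool" where
  "NQPR d Q \<longleftrightarrow>
     (\<forall>j < d^2. hermitian_op d (Q j) \<and> tr (Q j) = 1) \<and>
     (\<forall>j < d^2. \<forall>k < d^2. tr (Q j * Q k) = (if j = k then of_nat d else 0))"

text \<open>U^Q_{jk} = tr(Q_j U Q_k U^dagger)/d; this trace is real (trace of a product of two
  Hermitian matrices), so we take its real part.\<close>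
definition UQ :: "nat \<Rightarrow> (nat \<Rightarrow> complex mat) \<Rightarrow> complex mat \<Rightarrow> nat \<Rightarrow> nat \<Rightarrow> real" where
  "UQ d Q U j k = Re (tr (Q j * U * Q k * adj U)) / real d"

definition NU_unitary :: "nat \<Rightarrow> (nat \<Rightarrow> complex mat) \<Rightarrow> complex mat \<Rightarrow> real" where
  "NU_unitary d Q U = - real d * Min {UQ d Q U j k | j k. j < d^2 \<and> k < d^2}"

text \<open>Unitary negativity of the NQPR: the maximum (here: supremum, which is attained by
  compactness of the unitary group) over all unitaries.\<close>
definition NU :: "nat \<Rightarrow> (nat \<Rightarrow> complex mat) \<Rightarrow> real" where
  "NU d Q = Sup {NU_unitary d Q U | U. unitary_op d U}"

definition SIC :: "nat \<Rightarrow> (nat \<Rightarrow> complex mat) \<Rightarrow> bool" where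
  "SIC d P \<longleftrightarrow>
     (\<forall>j < d^2. rank_one_projector d (P j)) \<and>
     (\<forall>j < d^2. \<forall>k < d^2. tr (P j * P k) =
        (of_nat d * (if j = k then 1 else 0) + 1) / (of_nat d + 1))"

definition Qplus :: "nat \<Rightarrow> (nat \<Rightarrow> complex mat) \<Rightarrow> nat \<Rightarrow> complex mat" where
  "Qplus d P j = (complex_of_real (- sqrt (real d + 1))) \<cdot>\<^sub>m P j +
                 (complex_of_real ((1 + sqrt (real d + 1)) / real d)) \<cdot>\<^sub>m 1\<^sub>m d"

definition Qminus :: "nat \<Rightarrow> (nat \<Rightarrow> complex mat) \<Rightarrow> nat \<Rightarrow> complex mat" where
  "Qminus d P j = (complex_of_real (sqrt (real d + 1))) \<cdot>\<^sub>m P j +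
                  (complex_of_real ((1 - sqrt (real d + 1)) / real d)) \<cdot>\<^sub>m 1\<^sub>m d"

end

theory Submission
  imports Defs "Jordan_Normal_Form.Spectral_Radius" "HOL-Combinatorics.Cycles"
begin

text \<open>Conjugating by unitaries that permute an eigenbasis, \<open>tr (Q\<^sub>j U Q\<^sub>j U\<^sup>\<dagger>)\<close> takes all values
  \<open>\<Sum>i. l i * l (\<sigma> i)\<close> with \<open>l\<close> the spectrum of \<open>Q\<^sub>j\<close> and \<open>\<sigma>\<close> a permutation. The nontrivial powers
  of a \<open>d\<close>-cycle average to \<open>((\<Sum>i. l i)\<^sup>2 - (\<Sum>i. (l i)\<^sup>2)) / (d - 1) = -1\<close>, which gives the lower
  bound. In case of equality every \<open>d\<close>-cycle attains the minimum over all permutations, so exchanging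
  two of its values never lowers the sum; this forces all eigenvalues but one to agree, that is,
  \<open>Q\<^sub>j = \<alpha> P + (1 - \<alpha>)/d\<close> with \<open>P\<close> a rank-one projector and \<open>\<alpha>\<^sup>2 = d + 1\<close>. If \<open>d > 2\<close>, opposite
  signs of \<open>\<alpha>\<close> for two indices would produce the value \<open>2/d - d < -1\<close>; if \<open>d = 2\<close>, passing to the
  complementary projector flips the sign. The upper bound is \<open>(tr C)\<^sup>2 \<le> d tr C\<^sup>2\<close> for
  \<open>C = Q\<^sub>j + U Q\<^sub>k U\<^sup>\<dagger>\<close>.\<close>

section \<open>Adjoint, trace and unitary conjugation\<close>

lemma adj_carrier [simp]: "A \<in> carrier_mat n m \<Longrightarrow> adj A \<in> carrier_mat m n"
  by (auto simp: adj_def)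

lemma dim_adj [simp]: "dim_row (adj A) = dim_col A" "dim_col (adj A) = dim_row A"
  by (auto simp: adj_def)

lemma index_adj [simp]:
  "i < dim_col A \<Longrightarrow> j < dim_row A \<Longrightarrow> adj A $$ (i,j) = cnj (A $$ (j,i))"
  by (auto simp: adj_def)

lemma adj_adj [simp]: "adj (adj A) = A"
  by (rule eq_matI) auto

lemma adj_one [simp]: "adj (1\<^sub>m n) = 1\<^sub>m n"
  by (rule eq_matI) auto

lemma adj_add: "A \<in> carrier_mat n m \<Longrightarrow> B \<in> carrier_mat n m \<Longrightarrow> adj (A + B) = adj A + adj B"
  by (rule eq_matI) auto

lemma adj_mult:
  assumes "A \<in> carrier_mat n m" "B \<in> carrier_mat m p"
  shows "adj (A * B) = adj B * adj A"
  using assms by (intro eq_matI) (auto simp: scalar_prod_def mult.commute intro!: sum.cong)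

lemma tr_one [simp]: "tr (1\<^sub>m n) = of_nat n"
  by (simp add: tr_def)

lemma tr_smult: "A \<in> carrier_mat n n \<Longrightarrow> tr (c \<cdot>\<^sub>m A) = c * tr A"
  by (auto simp: tr_def sum_distrib_left)

lemma tr_add: "A \<in> carrier_mat n n \<Longrightarrow> B \<in> carrier_mat n n \<Longrightarrow> tr (A + B) = tr A + tr B"
  by (auto simp: tr_def sum.distrib)

lemma tr_mult:
  assumes "A \<in> carrier_mat n m" "B \<in> carrier_mat m n"
  shows "tr (A * B) = (\<Sum>i<n. \<Sum>k<m. A $$ (i,k) * B $$ (k,i))"
  using assms by (auto simp: tr_def scalar_prod_def lessThan_atLeast0 intro!: sum.cong)

lemma tr_mult_commute:
  assumes "A \<in> carrier_mat n m" "B \<in> carrier_mat m n"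
  shows "tr (A * B) = tr (B * A)"
  unfolding tr_mult[OF assms] tr_mult[OF assms(2,1)]
  by (subst sum.swap) (simp add: mult.commute)

lemma tr_mat_diag: "tr (mat_diag n f) = (\<Sum>i<n. f i)"
  by (simp add: tr_def mat_diag_def)

lemmas square_mat_simps =
  mult_carrier_mat[of _ n n _ n for n]
  assoc_mult_mat[of _ n n _ n _ n for n]
  add_mult_distrib_mat[of _ n n _ _ n for n]
  mult_add_distrib_mat[of _ n n _ n for n]
  mult_smult_distrib[of _ n n _ n for n]
  mult_smult_assoc_mat[of _ n n _ n for n]
  adj_mult[of _ n n _ n for n]
  tr_add[of _ n for n]
  tr_smult[of _ n for n]

lemma unitary_op_carrier: "unitary_op d U \<Longrightarrow> U \<in> carrier_mat d d"
  by (simp add: unitary_op_def)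

lemma unitary_op_iff_adj_mult:
  assumes "U \<in> carrier_mat d d"
  shows "unitary_op d U \<longleftrightarrow> adj U * U = 1\<^sub>m d"
  using assms mat_mult_left_right_inverse[of U d "adj U"]
    mat_mult_left_right_inverse[of "adj U" d U]
  by (auto simp: unitary_op_def)

lemma unitary_op_one: "unitary_op d (1\<^sub>m d)"
  by (auto simp: unitary_op_def)

lemma unitary_op_adj: "unitary_op d U \<Longrightarrow> unitary_op d (adj U)"
  using unitary_op_iff_adj_mult[of U d] by (auto simp: unitary_op_def)

lemma unitary_op_adj_mult_cancel:
  assumes "unitary_op d U" "A \<in> carrier_mat d d"
  shows "adj U * (U * A) = A"
  using assms unitary_op_iff_adj_mult[of U d] assoc_mult_mat[of "adj U" d d U d A d]
  by (simp add: unitary_op_carrier)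

lemma unitary_op_mult:
  assumes "unitary_op d U" "unitary_op d V"
  shows "unitary_op d (U * V)"
proof -
  have carriers: "U \<in> carrier_mat d d" "V \<in> carrier_mat d d"
    using assms by (simp_all add: unitary_op_carrier)
  then show ?thesis
    using assms unitary_op_adj_mult_cancel[OF assms(1) carriers(2)]
    by (simp add: unitary_op_iff_adj_mult square_mat_simps[where n = d])
qed

definition unitary_conj :: "complex mat \<Rightarrow> complex mat \<Rightarrow> complex mat" where
  "unitary_conj U A = U * A * adj U"

lemma unitary_conj_carrier [simp]:
  "U \<in> carrier_mat d d \<Longrightarrow> A \<in> carrier_mat d d \<Longrightarrow> unitary_conj U A \<in> carrier_mat d d"
  by (simp add: unitary_conj_def square_mat_simps[where n = d])

lemma unitary_conj_unitary_conj:
  assumes "U \<in> carrier_mat d d" "V \<in> carrier_mat d d" "A \<in> carrier_mat d d"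
  shows "unitary_conj U (unitary_conj V A) = unitary_conj (U * V) A"
  using assms by (simp add: unitary_conj_def square_mat_simps[where n = d])

lemma unitary_conj_adj_cancel:
  assumes "unitary_op d U" "A \<in> carrier_mat d d"
  shows "unitary_conj (adj U) (unitary_conj U A) = A"
    and "unitary_conj U (unitary_conj (adj U) A) = A"
  using assms unitary_op_iff_adj_mult[of U d] unitary_op_carrier[OF assms(1)]
  by (auto simp: unitary_conj_unitary_conj[where d = d])
     (auto simp: unitary_conj_def unitary_op_def)

lemma unitary_conj_mult:
  assumes "unitary_op d U" "A \<in> carrier_mat d d" "B \<in> carrier_mat d d"
  shows "unitary_conj U A * unitary_conj U B = unitary_conj U (A * B)"
  using assms unitary_op_carrier[OF assms(1)]
  by (simp add: unitary_conj_def square_mat_simps[where n = d] unitary_op_adj_mult_cancel)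

lemma tr_unitary_conj:
  assumes "unitary_op d U" "A \<in> carrier_mat d d"
  shows "tr (unitary_conj U A) = tr A"
  using assms unitary_op_carrier[OF assms(1)] tr_mult_commute[of "U * A" d d "adj U"]
  by (simp add: unitary_conj_def square_mat_simps[where n = d] unitary_op_adj_mult_cancel)

lemma hermitian_op_unitary_conj:
  assumes "U \<in> carrier_mat d d" "hermitian_op d A"
  shows "hermitian_op d (unitary_conj U A)"
  using assms by (simp add: hermitian_op_def unitary_conj_def square_mat_simps[where n = d])

section \<open>Diagonalization of Hermitian operators\<close>

lemma corthogonal_imp_unitary_columns:
  fixes ws :: "complex vec list"
  assumes ws: "set ws \<subseteq> carrier_vec n" "corthogonal ws" "length ws = n"
  obtains U r where "unitary_op n U" "\<And>j. j < n \<Longrightarrow> col U j = r j \<cdot>\<^sub>v ws ! j"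
proof -
  have ws_carrier: "ws ! j \<in> carrier_vec n" if "j < n" for j
    using ws that by auto
  define r where "r j = inverse (complex_of_real (sqrt (Re (ws ! j \<bullet>c ws ! j))))" for j
  have normalized: "r j * r j * (ws ! j \<bullet>c ws ! j) = 1" if j: "j < n" for j
  proof -
    have "ws ! j \<bullet>c ws ! j \<noteq> 0"
      using corthogonalD[OF ws(2), of j j] j ws(3) by auto
    moreover have "ws ! j \<bullet>c ws ! j \<ge> 0"
      by (rule conjugate_square_ge_0_vec)
    ultimately have "0 < Re (ws ! j \<bullet>c ws ! j)" "ws ! j \<bullet>c ws ! j = of_real (Re (ws ! j \<bullet>c ws ! j))"
      by (auto simp: less_eq_complex_def complex_eq_iff)
    then obtain x where "0 < x" "ws ! j \<bullet>c ws ! j = complex_of_real x"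
      by blast
    then show ?thesis
      by (simp add: r_def field_simps flip: of_real_mult)
  qed
  define U where "U = mat n n (\<lambda>(i,j). r j * ws ! j $ i)"
  have U: "U \<in> carrier_mat n n" by (simp add: U_def)
  have "adj U * U = 1\<^sub>m n"
  proof (rule eq_matI)
    fix i j assume "i < dim_row (1\<^sub>m n :: complex mat)" "j < dim_col (1\<^sub>m n :: complex mat)"
    then have ij: "i < n" "j < n" by auto
    then have "(adj U * U) $$ (i,j) = r i * r j * (ws ! j \<bullet>c ws ! i)"
      using ws_carrier[of i] ws_carrier[of j]
      by (auto simp: U_def r_def scalar_prod_def sum_distrib_left intro!: sum.cong)
    also have "\<dots> = 1\<^sub>m n $$ (i,j)"
      using ij normalized corthogonalD[OF ws(2), of j i] ws(3) by auto
    finally show "(adj U * U) $$ (i,j) = 1\<^sub>m n $$ (i,j)" .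
  qed (use U in auto)
  then have "unitary_op n U" using unitary_op_iff_adj_mult[OF U] by simp
  moreover have "col U j = r j \<cdot>\<^sub>v ws ! j" if "j < n" for j
    using ws_carrier[OF that] that by (intro eq_vecI) (auto simp: U_def)
  ultimately show ?thesis by (rule that)
qed

lemma exists_unitary_extending_vec:
  assumes v: "v \<in> carrier_vec n" and nonzero: "v \<noteq> 0\<^sub>v n"
  obtains U c where "unitary_op n U" "col U 0 = c \<cdot>\<^sub>v v"
proof -
  interpret cof_vec_space n "TYPE(complex)" .
  note completion = basis_completion[OF v nonzero]
  define ws where "ws = gram_schmidt n (basis_completion v)"
  have ws: "set ws \<subseteq> carrier_vec n" "corthogonal ws" "length ws = n"
    using gram_schmidt_result[OF completion(2,4,5) ws_def] completion(6) by auto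
  have n: "0 < n" using v nonzero by (cases n) auto
  have "ws ! 0 = v"
    using gram_schmidt_hd[OF v] completion(6,7) n ws(3) ws_def
    by (metis hd_conv_nth length_greater_0_conv list.collapse)
  moreover obtain U r where "unitary_op n U" "\<And>j. j < n \<Longrightarrow> col U j = r j \<cdot>\<^sub>v ws ! j"
    using corthogonal_imp_unitary_columns[OF ws] by blast
  ultimately show ?thesis using that n by metis
qed

definition bordered_mat :: "complex \<Rightarrow> complex mat \<Rightarrow> complex mat" where
  "bordered_mat a M = four_block_mat (mat 1 1 (\<lambda>_. a)) (0\<^sub>m 1 (dim_col M)) (0\<^sub>m (dim_row M) 1) M"

lemma bordered_mat_carrier [simp]:
  "M \<in> carrier_mat n n \<Longrightarrow> bordered_mat a M \<in> carrier_mat (Suc n) (Suc n)"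
  by (auto simp: bordered_mat_def)

lemma bordered_mat_mult:
  assumes "M \<in> carrier_mat n n" "N \<in> carrier_mat n n"
  shows "bordered_mat a M * bordered_mat b N = bordered_mat (a * b) (M * N)"
proof -
  have "mat 1 1 (\<lambda>_. a) * mat 1 1 (\<lambda>_. b) = mat 1 1 (\<lambda>_. a * b)"
    by (rule eq_matI) (auto simp: scalar_prod_def)
  then show ?thesis
    using assms unfolding bordered_mat_def
    by (subst mult_four_block_mat[of _ 1 1 _ n _ n _ _ 1 _ n])
       (auto intro!: arg_cong2[where f="\<lambda>x y. four_block_mat x _ _ y"])
qed

lemma adj_bordered_mat:
  "M \<in> carrier_mat n n \<Longrightarrow> adj (bordered_mat a M) = bordered_mat (cnj a) (adj M)"
  by (rule eq_matI) (auto simp: bordered_mat_def)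

lemma bordered_mat_one: "bordered_mat 1 (1\<^sub>m n) = 1\<^sub>m (Suc n)"
  by (rule eq_matI) (auto simp: bordered_mat_def)

lemma bordered_mat_diag: "bordered_mat a (mat_diag n f) = mat_diag (Suc n) (case_nat a f)"
  by (rule eq_matI) (auto simp: bordered_mat_def mat_diag_def split: nat.splits)

lemma unitary_op_bordered_mat: "unitary_op n V \<Longrightarrow> unitary_op (Suc n) (bordered_mat 1 V)"
  by (auto simp: unitary_op_def adj_bordered_mat bordered_mat_mult[where n = n] bordered_mat_one)

lemma unitary_conj_bordered_mat:
  assumes "V \<in> carrier_mat n n" "A \<in> carrier_mat n n"
  shows "unitary_conj (bordered_mat 1 V) (bordered_mat a A) = bordered_mat a (unitary_conj V A)"
  using assms
  by (simp add: unitary_conj_def adj_bordered_mat bordered_mat_mult[where n = n]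
      mult_carrier_mat[where nr = n and n = n and nc = n])

lemma hermitian_op_bordered:
  assumes B: "hermitian_op (Suc n) B" and col: "col B 0 = k \<cdot>\<^sub>v unit_vec (Suc n) 0"
  obtains a C where "hermitian_op n C" "B = bordered_mat (complex_of_real a) C"
proof -
  have carrier: "B \<in> carrier_mat (Suc n) (Suc n)" using B by (simp add: hermitian_op_def)
  have hermitian: "B $$ (i,j) = cnj (B $$ (j,i))" if "i < Suc n" "j < Suc n" for i j
    using B that by (metis hermitian_op_def index_adj carrier_matD)
  have col0: "B $$ (i,0) = (if i = 0 then k else 0)" if "i < Suc n" for i
    using arg_cong[OF col, of "\<lambda>w. w $ i"] carrier that by auto
  have k_real: "cnj k = k" "k = of_real (Re k)"
    using hermitian[of 0 0] col0[of 0] by (simp_all add: complex_eq_iff)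
  define C where "C = mat n n (\<lambda>(i,j). B $$ (Suc i, Suc j))"
  have "hermitian_op n C"
    unfolding hermitian_op_def by (auto intro!: eq_matI simp: C_def hermitian[symmetric])
  moreover have "B = bordered_mat (of_real (Re k)) C"
    using carrier col0 hermitian[of 0] k_real
    by (intro eq_matI) (auto simp: bordered_mat_def C_def)
  ultimately show ?thesis by (rule that)
qed

lemma hermitian_op_deflate:
  assumes A: "hermitian_op (Suc n) A"
  obtains W a C where "unitary_op (Suc n) W" "hermitian_op n C"
    "A = unitary_conj W (bordered_mat (complex_of_real a) C)"
proof -
  let ?n = "Suc n"
  have carrier: "A \<in> carrier_mat ?n ?n" using A by (simp add: hermitian_op_def)
  obtain k v where v: "v \<in> carrier_vec ?n" "v \<noteq> 0\<^sub>v ?n" "A *\<^sub>v v = k \<cdot>\<^sub>v v"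
    using spectrum_non_empty[OF carrier] carrier
    by (auto simp: spectrum_def eigenvalue_def eigenvector_def)
  obtain W s where W: "unitary_op ?n W" "col W 0 = s \<cdot>\<^sub>v v"
    using exists_unitary_extending_vec[OF v(1,2)] by blast
  note W_carrier = unitary_op_carrier[OF W(1)]
  define B where "B = unitary_conj (adj W) A"
  have "B = adj W * (A * W)"
    using carrier W_carrier by (simp add: B_def unitary_conj_def square_mat_simps[where n = ?n])
  then have "col B 0 = adj W *\<^sub>v (A *\<^sub>v col W 0)"
    using carrier W_carrier col_mult2[of "adj W" ?n ?n "A * W" ?n 0] col_mult2[of A ?n ?n W ?n 0]
    by (simp only: adj_carrier mult_carrier_mat zero_less_Suc)
  also have "A *\<^sub>v col W 0 = k \<cdot>\<^sub>v col W 0"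
    using v carrier by (simp add: W(2) mult_mat_vec smult_smult_assoc mult.commute)
  also have "adj W *\<^sub>v (k \<cdot>\<^sub>v col W 0) = k \<cdot>\<^sub>v col (adj W * W) 0"
    using W_carrier by (simp add: mult_mat_vec[of _ ?n ?n] carrier_vecI col_mult2[of _ ?n ?n _ ?n])
  also have "\<dots> = k \<cdot>\<^sub>v unit_vec ?n 0"
    using W(1) W_carrier by (simp add: unitary_op_iff_adj_mult)
  finally have "col B 0 = k \<cdot>\<^sub>v unit_vec ?n 0" .
  moreover have "hermitian_op ?n B"
    unfolding B_def by (rule hermitian_op_unitary_conj) (use W_carrier A in auto)
  ultimately obtain a C where "hermitian_op n C" "B = bordered_mat (complex_of_real a) C"
    using hermitian_op_bordered by blast
  moreover have "A = unitary_conj W B"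
    using unitary_conj_adj_cancel(2)[OF W(1) carrier] by (simp add: B_def)
  ultimately show ?thesis using W(1) that by blast
qed

theorem hermitian_op_diagonalize:
  assumes "hermitian_op n A"
  obtains V l where "unitary_op n V" "A = unitary_conj V (mat_diag n (\<lambda>i. complex_of_real (l i)))"
  using assms
proof (induction n arbitrary: A thesis)
  case 0
  then have "A = unitary_conj (1\<^sub>m 0) (mat_diag 0 (\<lambda>i. complex_of_real 0))"
    by (intro eq_matI) (auto simp: hermitian_op_def unitary_conj_def)
  then show ?case by (rule "0.prems"(1)[OF unitary_op_one])
next
  case (Suc n)
  obtain W a C where W: "unitary_op (Suc n) W" and C: "hermitian_op n C"
    and A: "A = unitary_conj W (bordered_mat (of_real a) C)"
    using hermitian_op_deflate[OF Suc.prems(2)] by blast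
  obtain V l where V: "unitary_op n V" "C = unitary_conj V (mat_diag n (\<lambda>i. of_real (l i)))"
    using Suc.IH[OF _ C] by blast
  let ?V = "bordered_mat 1 V" and ?D = "mat_diag (Suc n) (\<lambda>i. complex_of_real (case_nat a l i))"
  have "bordered_mat (of_real a) (mat_diag n (\<lambda>i. of_real (l i))) = ?D"
    unfolding bordered_mat_diag by (rule arg_cong[where f = "mat_diag _"]) (auto split: nat.splits)
  then have "bordered_mat (of_real a) C = unitary_conj ?V ?D"
    using unitary_conj_bordered_mat[OF unitary_op_carrier[OF V(1)] mat_diag_dim] V(2) by metis
  then have "A = unitary_conj (W * ?V) ?D"
    using A unitary_op_carrier[OF W] unitary_op_carrier[OF V(1)]
    by (simp add: unitary_conj_unitary_conj[where d = "Suc n"])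
  then show ?case
    using Suc.prems(1) unitary_op_mult[OF W unitary_op_bordered_mat[OF V(1)]] by blast
qed

section \<open>Autocorrelations of a finite family of reals\<close>

definition autocorrelation :: "'a set \<Rightarrow> ('a \<Rightarrow> real) \<Rightarrow> ('a \<Rightarrow> 'a) \<Rightarrow> real" where
  "autocorrelation S l \<sigma> = (\<Sum>x\<in>S. l x * l (\<sigma> x))"

text \<open>For a singleton \<open>S\<close> the denominator, and with it the mean, is \<open>0\<close>.\<close>

definition offdiag_mean :: "'a set \<Rightarrow> ('a \<Rightarrow> real) \<Rightarrow> real" where
  "offdiag_mean S l = ((\<Sum>x\<in>S. l x)\<^sup>2 - (\<Sum>x\<in>S. (l x)\<^sup>2)) / (real (card S) - 1)"

lemma cycle_of_list_funpow_nth: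
  assumes "distinct cs" "i < length cs"
  shows "(cycle_of_list cs ^^ k) (cs ! i) = cs ! ((i + k) mod length cs)"
proof -
  have "(cycle_of_list cs ^^ k) (cs ! i) = rotate k cs ! i"
    using assms(2) by (simp flip: cyclic_rotation[OF assms(1)])
  then show ?thesis using assms(2) by (simp add: nth_rotate add.commute)
qed

lemma cycle_of_list_append_Cons_Cons:
  assumes "distinct (as @ x # y # bs)"
  shows "cycle_of_list (as @ x # y # bs) x = y"
  using cycle_of_list_funpow_nth[OF assms, of "length as" 1] by (simp add: nth_append)

lemma sum_funpow_cycle_of_list:
  assumes "distinct cs" "x \<in> set cs"
  shows "(\<Sum>k<length cs. l ((cycle_of_list cs ^^ k) x)) = (\<Sum>y\<in>set cs. l y)"
proof -
  obtain i where i: "i < length cs" "x = cs ! i" using assms(2) by (metis in_set_conv_nth)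
  have "(\<Sum>k<length cs. l ((cycle_of_list cs ^^ k) x)) = (\<Sum>k<length cs. map l (rotate i cs) ! k)"
    using assms i by (intro sum.cong) (simp_all add: cycle_of_list_funpow_nth nth_rotate)
  also have "\<dots> = sum_list (map l (rotate i cs))"
    by (simp add: sum_list_sum_nth lessThan_atLeast0)
  also have "\<dots> = (\<Sum>y\<in>set cs. l y)"
    using assms(1) by (simp add: sum_list_distinct_conv_sum_set)
  finally show ?thesis .
qed

lemma sum_autocorrelation_funpow_cycle:
  assumes cs: "distinct cs" "2 \<le> length cs"
  shows "(\<Sum>k\<in>{1..<length cs}. autocorrelation (set cs) l (cycle_of_list cs ^^ k))
    = (real (length cs) - 1) * offdiag_mean (set cs) l"
proof -
  let ?c = "\<lambda>k. autocorrelation (set cs) l (cycle_of_list cs ^^ k)"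
  have "(\<Sum>k<length cs. ?c k) = (\<Sum>x\<in>set cs. l x * (\<Sum>k<length cs. l ((cycle_of_list cs ^^ k) x)))"
    unfolding autocorrelation_def sum_distrib_left by (rule sum.swap)
  also have "\<dots> = (\<Sum>x\<in>set cs. l x)\<^sup>2"
    using cs by (simp add: sum_funpow_cycle_of_list sum_distrib_right power2_eq_square)
  finally have "(\<Sum>k<length cs. ?c k) = (\<Sum>x\<in>set cs. l x)\<^sup>2" .
  moreover have "{..<length cs} = insert 0 {1..<length cs}" using cs by auto
  ultimately have "(\<Sum>k\<in>{1..<length cs}. ?c k) = (\<Sum>x\<in>set cs. l x)\<^sup>2 - (\<Sum>x\<in>set cs. (l x)\<^sup>2)"
    by (simp add: autocorrelation_def power2_eq_square)
  then show ?thesis using cs by (simp add: offdiag_mean_def distinct_card)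
qed

lemma exists_permutes_autocorrelation_le:
  assumes S: "finite S" "2 \<le> card S"
  shows "\<exists>\<sigma>. \<sigma> permutes S \<and> autocorrelation S l \<sigma> \<le> offdiag_mean S l"
proof (rule ccontr)
  obtain cs where cs: "set cs = S" "distinct cs" using finite_distinct_list[OF S(1)] by blast
  then have len: "2 \<le> length cs" using S(2) distinct_card by fastforce
  assume "\<not> ?thesis"
  then have "offdiag_mean S l < autocorrelation S l (cycle_of_list cs ^^ k)" for k
    using permutes_funpow[OF cycle_permutes[of cs], of k] cs(1) by force
  then have "(\<Sum>k\<in>{1..<length cs}. offdiag_mean S l)
      < (\<Sum>k\<in>{1..<length cs}. autocorrelation S l (cycle_of_list cs ^^ k))"
    using len by (intro sum_strict_mono) auto
  then show False
    using sum_autocorrelation_funpow_cycle[OF cs(2) len, of l] cs(1) len by simp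
qed

lemma autocorrelation_cycle_eq_offdiag_mean:
  assumes cs: "distinct cs" "2 \<le> length cs"
    and lower: "\<And>\<sigma>. \<sigma> permutes set cs \<Longrightarrow> offdiag_mean (set cs) l \<le> autocorrelation (set cs) l \<sigma>"
  shows "autocorrelation (set cs) l (cycle_of_list cs) = offdiag_mean (set cs) l"
proof -
  let ?e = "\<lambda>k. autocorrelation (set cs) l (cycle_of_list cs ^^ k) - offdiag_mean (set cs) l"
  have "(\<Sum>k\<in>{1..<length cs}. ?e k) = 0"
    using sum_autocorrelation_funpow_cycle[OF cs, of l] cs(2) by (simp add: sum_subtractf)
  moreover have "0 \<le> ?e k" for k
    using lower permutes_funpow[OF cycle_permutes[of cs]] by simp
  ultimately have "\<forall>k\<in>{1..<length cs}. ?e k = 0"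
    by (simp add: sum_nonneg_eq_0_iff)
  from bspec[OF this, of 1] show ?thesis using cs(2) by simp
qed

lemma minimal_autocorrelation_exchange:
  assumes S: "finite S" "x \<in> S" "y \<in> S" "x \<noteq> y" and \<sigma>: "\<sigma> permutes S"
    and min: "\<And>\<tau>. \<tau> permutes S \<Longrightarrow> autocorrelation S l \<sigma> \<le> autocorrelation S l \<tau>"
  shows "(l x - l y) * (l (\<sigma> x) - l (\<sigma> y)) \<le> 0"
proof -
  let ?t = "transpose x y"
  have "0 \<le> autocorrelation S l (\<sigma> \<circ> ?t) - autocorrelation S l \<sigma>"
    using min[OF permutes_compose[OF permutes_swap_id[OF S(2,3)] \<sigma>]] by simp
  also have "\<dots> = (\<Sum>z\<in>S. l z * l (\<sigma> (?t z)) - l z * l (\<sigma> z))"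
    by (simp add: autocorrelation_def sum_subtractf)
  also have "\<dots> = (\<Sum>z\<in>{x,y}. l z * l (\<sigma> (?t z)) - l z * l (\<sigma> z))"
    using S by (intro sum.mono_neutral_right) (auto simp: transpose_def)
  also have "\<dots> = - ((l x - l y) * (l (\<sigma> x) - l (\<sigma> y)))"
    using S(4) by (simp add: algebra_simps)
  finally show ?thesis by simp
qed

lemma constant_off_one_point:
  fixes l :: "'a \<Rightarrow> 'b::linorder"
  assumes nonempty: "S \<noteq> {}"
    and no_chain: "\<And>a b c. {a, b, c} \<subseteq> S \<Longrightarrow> l a < l b \<Longrightarrow> l b < l c \<Longrightarrow> False"
    and equal_pairs: "\<And>a b c e. {a, b, c, e} \<subseteq> S \<Longrightarrow> a \<noteq> b \<Longrightarrow> c \<noteq> e \<Longrightarrow>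
      l a = l b \<Longrightarrow> l c = l e \<Longrightarrow> l a = l c"
  obtains m c where "m \<in> S" "\<And>x. x \<in> S \<Longrightarrow> x \<noteq> m \<Longrightarrow> l x = c"
proof (cases "\<exists>i\<in>S. \<exists>j\<in>S. l i < l j")
  case False
  then show ?thesis using nonempty that by (meson ex_in_conv linorder_neqE)
next
  case True
  then obtain i j where ij: "i \<in> S" "j \<in> S" "l i < l j" by blast
  have two_values: "l x = l i \<or> l x = l j" if "x \<in> S" for x
    using no_chain[of x i j] no_chain[of i x j] no_chain[of i j x] ij that
    by (metis empty_subsetI insert_subset linorder_neqE)
  show ?thesis
  proof (cases "\<exists>x\<in>S. x \<noteq> i \<and> l x = l i")
    case True
    then have "l y = l i" if "y \<in> S" "y \<noteq> j" for y
      using equal_pairs[of i _ j y] ij two_values[OF that(1)] that by force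
    then show ?thesis using ij(2) that by blast
  next
    case False
    then show ?thesis using ij(1) two_values that by blast
  qed
qed

lemma cycle_exchange_of_offdiag_mean_le:
  assumes S: "finite S" "2 \<le> card S"
    and lower: "\<And>\<sigma>. \<sigma> permutes S \<Longrightarrow> offdiag_mean S l \<le> autocorrelation S l \<sigma>"
    and cs: "distinct cs" "set cs = S" "x \<in> S" "y \<in> S" "x \<noteq> y"
  shows "(l x - l y) * (l (cycle_of_list cs x) - l (cycle_of_list cs y)) \<le> 0"
proof (rule minimal_autocorrelation_exchange[OF S(1) cs(3-5)])
  show "cycle_of_list cs permutes S" using cycle_permutes cs(2) by metis
  have "2 \<le> length cs" using S(2) cs(1,2) distinct_card by fastforce
  then show "autocorrelation S l (cycle_of_list cs) \<le> autocorrelation S l \<tau>" if "\<tau> permutes S" for \<tau>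
    using autocorrelation_cycle_eq_offdiag_mean[OF cs(1), of l] lower that cs(2) by simp
qed

lemma finite_distinct_list_extending:
  assumes "finite S" "distinct as" "set as \<subseteq> S"
  obtains bs where "distinct (as @ bs)" "set (as @ bs) = S"
proof -
  obtain bs where "set bs = S - set as" "distinct bs"
    using finite_distinct_list[of "S - set as"] assms(1) by auto
  then show ?thesis using that[of bs] assms by auto
qed

theorem offdiag_mean_le_autocorrelation_imp_constant_off_one_point:
  assumes S: "finite S" "2 \<le> card S"
    and lower: "\<And>\<sigma>. \<sigma> permutes S \<Longrightarrow> offdiag_mean S l \<le> autocorrelation S l \<sigma>"
  obtains m c where "m \<in> S" "\<And>x. x \<in> S \<Longrightarrow> x \<noteq> m \<Longrightarrow> l x = c"
proof (rule constant_off_one_point[of S l])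
  have exchange: "(l x - l y) * (l (cycle_of_list cs x) - l (cycle_of_list cs y)) \<le> 0"
    if "distinct cs" "set cs = S" "x \<in> S" "y \<in> S" "x \<noteq> y" for cs x y
    by (rule cycle_exchange_of_offdiag_mean_le[OF S]) (use lower that in auto)
  show "S \<noteq> {}" using S by auto
  show False if abc: "{a, b, c} \<subseteq> S" "l a < l b" "l b < l c" for a b c
  proof -
    have "distinct [a, b, c]" using abc(2,3) by auto
    then obtain rest where cs: "distinct ([a, b, c] @ rest)" "set ([a, b, c] @ rest) = S"
      using finite_distinct_list_extending[of S "[a, b, c]"] S(1) abc(1) by auto
    have "(l a - l b) * (l b - l c) \<le> 0"
      using exchange[OF cs, of a b] cs abc(1)
        cycle_of_list_append_Cons_Cons[of "[]" a b "c # rest"] cycle_of_list_append_Cons_Cons[of "[a]" b c rest]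
      by simp
    then show False using abc(2,3) by (simp add: mult_le_0_iff)
  qed
  show "l a = l c" if abce: "{a, b, c, e} \<subseteq> S" "a \<noteq> b" "c \<noteq> e" "l a = l b" "l c = l e" for a b c e
  proof (rule ccontr)
    assume distinct_values: "l a \<noteq> l c"
    then have "distinct [a, b, c, e]" using abce(2-) by auto
    then obtain rest where cs: "distinct ([a, b, c, e] @ rest)" "set ([a, b, c, e] @ rest) = S"
      using finite_distinct_list_extending[of S "[a, b, c, e]"] S(1) abce(1) by auto
    have "(l a - l c) * (l b - l e) \<le> 0"
      using exchange[OF cs, of a c] cs abce(1)
        cycle_of_list_append_Cons_Cons[of "[]" a b "c # e # rest"]
        cycle_of_list_append_Cons_Cons[of "[a, b]" c e rest]
      by simp
    then show False using abce(4,5) distinct_values by (auto simp: mult_le_0_iff)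
  qed
qed (rule that)

section \<open>Overlaps of a Hermitian operator with its unitary conjugates\<close>

definition perm_op :: "nat \<Rightarrow> (nat \<Rightarrow> nat) \<Rightarrow> complex mat" where
  "perm_op d \<sigma> = mat d d (\<lambda>(i,j). if j = \<sigma> i then 1 else 0)"

lemma perm_op_carrier [simp]: "perm_op d \<sigma> \<in> carrier_mat d d"
  by (simp add: perm_op_def)

lemma unitary_op_perm_op:
  assumes \<sigma>: "\<sigma> permutes {..<d}"
  shows "unitary_op d (perm_op d \<sigma>)"
proof -
  have "perm_op d \<sigma> * adj (perm_op d \<sigma>) = 1\<^sub>m d"
  proof (rule eq_matI)
    fix i j assume "i < dim_row (1\<^sub>m d :: complex mat)" "j < dim_col (1\<^sub>m d :: complex mat)"
    then have ij: "i < d" "j < d" by auto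
    then have "(perm_op d \<sigma> * adj (perm_op d \<sigma>)) $$ (i,j)
        = (\<Sum>k<d. (if k = \<sigma> i then 1 else 0) * cnj (if k = \<sigma> j then 1 else 0))"
      by (simp add: perm_op_def scalar_prod_def lessThan_atLeast0)
    also have "\<dots> = (\<Sum>k<d. if k = \<sigma> i then (if \<sigma> i = \<sigma> j then 1 else 0) else 0)"
      by (intro sum.cong) auto
    also have "\<dots> = 1\<^sub>m d $$ (i,j)"
      using ij permutes_in_image[OF \<sigma>, of i] inj_eq[OF permutes_inj[OF \<sigma>]] by simp
    finally show "(perm_op d \<sigma> * adj (perm_op d \<sigma>)) $$ (i,j) = 1\<^sub>m d $$ (i,j)" .
  qed (simp_all add: perm_op_def)
  then show ?thesis by (simp add: unitary_op_def)
qed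

lemma unitary_conj_perm_op_mat_diag:
  assumes \<sigma>: "\<sigma> permutes {..<d}"
  shows "unitary_conj (perm_op d \<sigma>) (mat_diag d f) = mat_diag d (\<lambda>i. f (\<sigma> i))"
proof -
  have "perm_op d \<sigma> * mat_diag d f = mat_diag d (\<lambda>i. f (\<sigma> i)) * perm_op d \<sigma>"
    by (auto simp: mat_diag_mult_left[of _ d d] mat_diag_mult_right[of _ d d] perm_op_def
        intro!: eq_matI)
  then show ?thesis
    using unitary_op_perm_op[OF \<sigma>]
    by (simp add: unitary_conj_def unitary_op_def square_mat_simps[where n = d]
        right_mult_one_mat[of _ d d])
qed

lemma exists_unitary_permuting_eigenvalues:
  assumes V: "unitary_op d V" "A = unitary_conj V (mat_diag d f)"
    and W: "unitary_op d W" "B = unitary_conj W (mat_diag d g)"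
    and \<sigma>: "\<sigma> permutes {..<d}"
  shows "\<exists>U. unitary_op d U \<and> tr (A * unitary_conj U B) = (\<Sum>i<d. f i * g (\<sigma> i))"
proof -
  let ?P = "perm_op d \<sigma>"
  define U where "U = V * ?P * adj W"
  have carriers: "V \<in> carrier_mat d d" "W \<in> carrier_mat d d"
    using V W by (auto simp: unitary_op_carrier)
  have "unitary_conj U B = unitary_conj V (unitary_conj ?P (unitary_conj (adj W) B))"
    using carriers
    by (simp add: U_def W(2) unitary_conj_unitary_conj[where d = d] square_mat_simps[where n = d])
  also have "\<dots> = unitary_conj V (mat_diag d (\<lambda>i. g (\<sigma> i)))"
    using unitary_conj_adj_cancel(1)[OF W(1) mat_diag_dim] \<sigma>
    by (simp add: W(2) unitary_conj_perm_op_mat_diag)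
  finally have "tr (A * unitary_conj U B) = (\<Sum>i<d. f i * g (\<sigma> i))"
    using V(1) by (simp add: V(2) unitary_conj_mult tr_unitary_conj tr_mat_diag)
  moreover have "unitary_op d U"
    unfolding U_def by (intro unitary_op_mult unitary_op_perm_op unitary_op_adj V W \<sigma>)
  ultimately show ?thesis by blast
qed

definition spectral_offdiag_mean :: "nat \<Rightarrow> complex mat \<Rightarrow> real" where
  "spectral_offdiag_mean d A = ((Re (tr A))\<^sup>2 - Re (tr (A * A))) / (real d - 1)"

lemma hermitian_op_spectrum:
  assumes "hermitian_op d A"
  obtains V l where "unitary_op d V" "A = unitary_conj V (mat_diag d (\<lambda>i. complex_of_real (l i)))"
    "Re (tr A) = (\<Sum>i<d. l i)" "Re (tr (A * A)) = (\<Sum>i<d. (l i)\<^sup>2)"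
proof -
  obtain V l where V: "unitary_op d V" "A = unitary_conj V (mat_diag d (\<lambda>i. complex_of_real (l i)))"
    using hermitian_op_diagonalize[OF assms] by blast
  have "Re (tr A) = (\<Sum>i<d. l i)"
    by (simp add: V(2) tr_unitary_conj[OF V(1)] tr_mat_diag)
  moreover have "Re (tr (A * A)) = (\<Sum>i<d. (l i)\<^sup>2)"
    using V(1) by (simp add: V(2) unitary_conj_mult tr_unitary_conj tr_mat_diag power2_eq_square)
  ultimately show ?thesis using V that by blast
qed

lemma exists_unitary_overlap_le:
  assumes d: "2 \<le> d" and A: "hermitian_op d A"
  shows "\<exists>U. unitary_op d U \<and>
    Re (tr (A * unitary_conj U A)) \<le> spectral_offdiag_mean d A"
proof -
  obtain V l where V: "unitary_op d V" "A = unitary_conj V (mat_diag d (\<lambda>i. complex_of_real (l i)))"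
    and spectral_sums: "Re (tr A) = (\<Sum>i<d. l i)" "Re (tr (A * A)) = (\<Sum>i<d. (l i)\<^sup>2)"
    using hermitian_op_spectrum[OF A] by blast
  obtain \<sigma> where \<sigma>: "\<sigma> permutes {..<d}" "autocorrelation {..<d} l \<sigma> \<le> offdiag_mean {..<d} l"
    using exists_permutes_autocorrelation_le[of "{..<d}" l] d by auto
  obtain U where "unitary_op d U"
      "tr (A * unitary_conj U A) = (\<Sum>i<d. complex_of_real (l i) * complex_of_real (l (\<sigma> i)))"
    using exists_unitary_permuting_eigenvalues[OF V V \<sigma>(1)] by blast
  then show ?thesis
    using \<sigma>(2)
    by (intro exI[of _ U])
       (simp add: autocorrelation_def offdiag_mean_def spectral_offdiag_mean_def spectral_sums)
qed

lemma overlap_ge_imp_constant_eigenvalues: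
  assumes d: "2 \<le> d" and A: "hermitian_op d A"
    and lower: "\<And>U. unitary_op d U \<Longrightarrow>
      spectral_offdiag_mean d A \<le> Re (tr (A * unitary_conj U A))"
  obtains V l m c where "unitary_op d V"
    "A = unitary_conj V (mat_diag d (\<lambda>i. complex_of_real (l i)))"
    "m < d" "\<And>i. i < d \<Longrightarrow> i \<noteq> m \<Longrightarrow> l i = c"
proof -
  obtain V l where V: "unitary_op d V" "A = unitary_conj V (mat_diag d (\<lambda>i. complex_of_real (l i)))"
    and spectral_sums: "Re (tr A) = (\<Sum>i<d. l i)" "Re (tr (A * A)) = (\<Sum>i<d. (l i)\<^sup>2)"
    using hermitian_op_spectrum[OF A] by blast
  have "offdiag_mean {..<d} l \<le> autocorrelation {..<d} l \<sigma>" if \<sigma>: "\<sigma> permutes {..<d}" for \<sigma>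
  proof -
    obtain U where "unitary_op d U"
      "tr (A * unitary_conj U A) = (\<Sum>i<d. complex_of_real (l i) * complex_of_real (l (\<sigma> i)))"
      using exists_unitary_permuting_eigenvalues[OF V V \<sigma>] by blast
    then show ?thesis
      using lower[of U]
      by (simp add: autocorrelation_def offdiag_mean_def spectral_offdiag_mean_def spectral_sums)
  qed
  then obtain m c where "m < d" "\<And>i. i < d \<Longrightarrow> i \<noteq> m \<Longrightarrow> l i = c"
    using offdiag_mean_le_autocorrelation_imp_constant_off_one_point[of "{..<d}" l] d by auto
  with V show ?thesis by (rule that)
qed

lemma sum_power2_le_card_mult_sum_power2:
  fixes l :: "'a \<Rightarrow> real"
  shows "(\<Sum>x\<in>S. l x)\<^sup>2 \<le> real (card S) * (\<Sum>x\<in>S. (l x)\<^sup>2)"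
proof (cases "S = {} \<or> infinite S")
  case False
  define n s where "n = real (card S)" and "s = (\<Sum>x\<in>S. l x)"
  have "0 \<le> (\<Sum>x\<in>S. (n * l x - s)\<^sup>2)" by (intro sum_nonneg) simp
  also have "\<dots> = n\<^sup>2 * (\<Sum>x\<in>S. (l x)\<^sup>2) - 2 * n * s * (\<Sum>x\<in>S. l x) + card S * s\<^sup>2"
    by (simp add: power2_diff power_mult_distrib sum.distrib sum_subtractf mult_ac
        flip: sum_distrib_left sum_distrib_right)
  also have "\<dots> = n * (n * (\<Sum>x\<in>S. (l x)\<^sup>2) - s\<^sup>2)"
    by (simp add: n_def s_def power2_eq_square algebra_simps)
  finally show ?thesis
    using False by (simp add: n_def s_def zero_le_mult_iff card_gt_0_iff)
qed auto

lemma hermitian_op_tr_power2_le: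
  assumes "hermitian_op d A"
  shows "(Re (tr A))\<^sup>2 \<le> real d * Re (tr (A * A))"
proof -
  obtain l where "Re (tr A) = (\<Sum>i<d. l i)" "Re (tr (A * A)) = (\<Sum>i<d. (l i)\<^sup>2)"
    using hermitian_op_spectrum[OF assms] by blast
  then show ?thesis using sum_power2_le_card_mult_sum_power2[of l "{..<d}"] by simp
qed

lemma hermitian_op_tr_mult_ge:
  assumes d: "0 < d" and A: "hermitian_op d A" and B: "hermitian_op d B"
  shows "(Re (tr A) + Re (tr B))\<^sup>2 / real d - Re (tr (A * A)) - Re (tr (B * B))
    \<le> 2 * Re (tr (A * B))"
proof -
  have carriers: "A \<in> carrier_mat d d" "B \<in> carrier_mat d d"
    using A B by (auto simp: hermitian_op_def)
  have "hermitian_op d (A + B)"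
    using A B by (auto simp: hermitian_op_def adj_add[of _ d d])
  from hermitian_op_tr_power2_le[OF this]
  have "(Re (tr A) + Re (tr B))\<^sup>2 / real d \<le> Re (tr ((A + B) * (A + B)))"
    using carriers d by (simp add: tr_add[of _ d] field_simps)
  also have "tr ((A + B) * (A + B)) = tr (A * A) + tr (B * B) + 2 * tr (A * B)"
    using carriers tr_mult_commute[OF carriers(2,1)] by (simp add: square_mat_simps[where n = d])
  finally show ?thesis by simp
qed

section \<open>Rank-one projectors\<close>

definition ket_bra :: "complex vec \<Rightarrow> complex mat" where
  "ket_bra v = mat (dim_vec v) (dim_vec v) (\<lambda>(i,j). v $ i * cnj (v $ j))"

lemma ket_bra_carrier [simp]: "v \<in> carrier_vec d \<Longrightarrow> ket_bra v \<in> carrier_mat d d"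
  by (simp add: ket_bra_def)

lemma tr_ket_bra: "tr (ket_bra v) = (\<Sum>i<dim_vec v. v $ i * cnj (v $ i))"
  by (simp add: tr_def ket_bra_def)

lemma rank_one_projector_iff_ket_bra:
  "rank_one_projector d P \<longleftrightarrow> (\<exists>v\<in>carrier_vec d. P = ket_bra v \<and> tr P = 1)"
proof
  assume "rank_one_projector d P"
  then obtain v :: "complex vec" where v: "dim_vec v = d" "(\<Sum>i<d. v $ i * cnj (v $ i)) = 1"
    and P: "P = mat d d (\<lambda>(i,j). v $ i * cnj (v $ j))"
    unfolding rank_one_projector_def by blast
  have "P = ket_bra v" using P v(1) by (simp add: ket_bra_def)
  moreover from this have "tr P = 1" using v by (simp only: tr_ket_bra)
  ultimately show "\<exists>v\<in>carrier_vec d. P = ket_bra v \<and> tr P = 1"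
    using carrier_vecI[OF v(1)] by blast
next
  assume "\<exists>v\<in>carrier_vec d. P = ket_bra v \<and> tr P = 1"
  then obtain v where v: "dim_vec v = d" "P = ket_bra v" "tr P = 1" using carrier_vecD by blast
  then have "(\<Sum>i<d. v $ i * cnj (v $ i)) = 1" by (metis tr_ket_bra)
  then show "rank_one_projector d P"
    using v(1,2) unfolding rank_one_projector_def ket_bra_def by blast
qed

lemma ket_bra_smult: "ket_bra (c \<cdot>\<^sub>v v) = (c * cnj c) \<cdot>\<^sub>m ket_bra v"
  by (rule eq_matI) (auto simp: ket_bra_def)

lemma ket_bra_unit_vec: "ket_bra (unit_vec d m) = mat_diag d (\<lambda>i. if i = m then 1 else 0)"
  by (rule eq_matI) (auto simp: ket_bra_def mat_diag_def unit_vec_def)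

lemma unitary_conj_ket_bra:
  assumes U: "U \<in> carrier_mat d d" and v: "v \<in> carrier_vec d"
  shows "unitary_conj U (ket_bra v) = ket_bra (U *\<^sub>v v)"
proof (rule eq_matI)
  fix i j assume "i < dim_row (ket_bra (U *\<^sub>v v))" "j < dim_col (ket_bra (U *\<^sub>v v))"
  then have ij: "i < d" "j < d" using U by (auto simp: ket_bra_def)
  have "unitary_conj U (ket_bra v) $$ (i,j)
      = (\<Sum>l<d. \<Sum>k<d. U $$ (i,k) * (v $ k * cnj (v $ l)) * cnj (U $$ (j,l)))"
    using U v ij unfolding unitary_conj_def
    by (auto simp: scalar_prod_def ket_bra_def sum_distrib_right lessThan_atLeast0 intro!: sum.cong)
  also have "\<dots> = (\<Sum>k<d. U $$ (i,k) * v $ k) * (\<Sum>l<d. cnj (U $$ (j,l) * v $ l))"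
    unfolding sum_product by (subst sum.swap) (simp add: mult_ac)
  also have "\<dots> = ket_bra (U *\<^sub>v v) $$ (i,j)"
    using U v ij by (simp add: ket_bra_def scalar_prod_def lessThan_atLeast0)
  finally show "unitary_conj U (ket_bra v) $$ (i,j) = ket_bra (U *\<^sub>v v) $$ (i,j)" .
qed (use U in \<open>auto simp: ket_bra_def unitary_conj_def\<close>)

lemma tr_ket_bra_eq_scalar_prod: "tr (ket_bra v) = v \<bullet>c v"
  by (simp add: tr_ket_bra scalar_prod_def lessThan_atLeast0)

lemma tr_ket_bra_mult_ket_bra:
  assumes "v \<in> carrier_vec d" "w \<in> carrier_vec d"
  shows "tr (ket_bra v * ket_bra w) = of_real ((cmod (v \<bullet>c w))\<^sup>2)"
proof -
  have scalar_prod_sum: "v \<bullet>c w = (\<Sum>i<d. v $ i * cnj (w $ i))"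
    using assms by (simp add: scalar_prod_def lessThan_atLeast0)
  have "tr (ket_bra v * ket_bra w) = (\<Sum>i<d. \<Sum>k<d. v $ i * cnj (w $ i) * cnj (v $ k * cnj (w $ k)))"
    using assms by (subst tr_mult[of _ d d]) (auto simp: ket_bra_def intro!: sum.cong)
  also have "\<dots> = (v \<bullet>c w) * cnj (v \<bullet>c w)"
    by (simp add: scalar_prod_sum sum_product)
  finally show ?thesis by (simp only: complex_norm_square)
qed

lemma rank_one_projector_carrier: "rank_one_projector d P \<Longrightarrow> P \<in> carrier_mat d d"
  by (auto simp: rank_one_projector_iff_ket_bra)

lemma tr_rank_one_projector: "rank_one_projector d P \<Longrightarrow> tr P = 1"
  by (auto simp: rank_one_projector_iff_ket_bra)

lemma rank_one_projector_tr_square: 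
  assumes "rank_one_projector d P"
  shows "tr (P * P) = 1"
proof -
  obtain v where v: "v \<in> carrier_vec d" "P = ket_bra v" "v \<bullet>c v = 1"
    using assms by (auto simp: rank_one_projector_iff_ket_bra tr_ket_bra_eq_scalar_prod)
  then show ?thesis using tr_ket_bra_mult_ket_bra[OF v(1,1)] by simp
qed

lemma rank_one_projector_overlap_nonneg:
  assumes "rank_one_projector d P" "rank_one_projector d R"
  shows "0 \<le> Re (tr (P * R))"
proof -
  obtain v w where "v \<in> carrier_vec d" "P = ket_bra v" "w \<in> carrier_vec d" "R = ket_bra w"
    using assms unfolding rank_one_projector_iff_ket_bra by blast
  then show ?thesis by (simp add: tr_ket_bra_mult_ket_bra del: of_real_power)
qed

lemma rank_one_projector_unitary_conj:
  assumes "unitary_op d U" "rank_one_projector d P"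
  shows "rank_one_projector d (unitary_conj U P)"
proof -
  obtain v where v: "v \<in> carrier_vec d" "P = ket_bra v" "tr P = 1"
    using assms(2) by (auto simp: rank_one_projector_iff_ket_bra)
  note U_carrier = unitary_op_carrier[OF assms(1)]
  have "tr (unitary_conj U P) = 1"
    using tr_unitary_conj[OF assms(1) rank_one_projector_carrier[OF assms(2)]] v(3) by simp
  moreover have "unitary_conj U P = ket_bra (U *\<^sub>v v)"
    unfolding v(2) by (rule unitary_conj_ket_bra[OF U_carrier v(1)])
  moreover have "U *\<^sub>v v \<in> carrier_vec d"
    using U_carrier v(1) by (rule mult_mat_vec_carrier)
  ultimately show ?thesis unfolding rank_one_projector_iff_ket_bra by blast
qed

lemma rank_one_projector_unit_vec:
  assumes "m < d" shows "rank_one_projector d (ket_bra (unit_vec d m))"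
proof -
  have "tr (ket_bra (unit_vec d m)) = 1"
    using assms by (simp add: ket_bra_unit_vec tr_mat_diag)
  then show ?thesis unfolding rank_one_projector_iff_ket_bra using unit_vec_carrier by blast
qed

lemma rank_one_projector_conj_unit_vec:
  assumes P: "rank_one_projector d P"
  obtains U where "unitary_op d U" "P = unitary_conj U (ket_bra (unit_vec d 0))"
proof -
  obtain v where v: "v \<in> carrier_vec d" "P = ket_bra v" "v \<bullet>c v = 1"
    using P by (auto simp: rank_one_projector_iff_ket_bra tr_ket_bra_eq_scalar_prod)
  then have "v \<noteq> 0\<^sub>v d" by auto
  then obtain U c where U: "unitary_op d U" "col U 0 = c \<cdot>\<^sub>v v"
    using exists_unitary_extending_vec[OF v(1)] by blast
  note U_carrier = unitary_op_carrier[OF U(1)]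
  have d: "0 < d" using v by (cases d) (auto simp: scalar_prod_def)
  have "U *\<^sub>v unit_vec d 0 = c \<cdot>\<^sub>v v"
    using U(2) U_carrier d by (intro eq_vecI) (auto simp flip: U(2))
  then have scaled: "unitary_conj U (ket_bra (unit_vec d 0)) = (c * cnj c) \<cdot>\<^sub>m P"
    using unitary_conj_ket_bra[OF U_carrier unit_vec_carrier] by (simp add: ket_bra_smult v(2))
  have "tr (unitary_conj U (ket_bra (unit_vec d 0))) = 1"
    using rank_one_projector_unit_vec[OF d] U(1)
    by (intro tr_rank_one_projector rank_one_projector_unitary_conj)
  then have "c * cnj c = 1"
    unfolding scaled using P tr_smult[OF rank_one_projector_carrier[OF P]]
    by (simp add: tr_rank_one_projector)
  moreover have "1 \<cdot>\<^sub>m P = P" by (rule eq_matI) auto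
  ultimately show ?thesis using that[OF U(1)] scaled by simp
qed

lemma rank_one_projectors_unitarily_equivalent:
  assumes "rank_one_projector d P" "rank_one_projector d R"
  obtains U where "unitary_op d U" "unitary_conj U R = P"
proof -
  obtain V where V: "unitary_op d V" "P = unitary_conj V (ket_bra (unit_vec d 0))"
    by (rule rank_one_projector_conj_unit_vec[OF assms(1)])
  obtain W where W: "unitary_op d W" "R = unitary_conj W (ket_bra (unit_vec d 0))"
    by (rule rank_one_projector_conj_unit_vec[OF assms(2)])
  have "unitary_conj (V * adj W) R = unitary_conj V (unitary_conj (adj W) R)"
    using V(1) W(1) rank_one_projector_carrier[OF assms(2)]
    by (intro unitary_conj_unitary_conj[where d = d, symmetric]) (auto simp: unitary_op_carrier)
  also have "\<dots> = P"
    using unitary_conj_adj_cancel(1)[OF W(1)] by (simp add: V(2) W(2))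
  finally show ?thesis
    using that[OF unitary_op_mult[OF V(1) unitary_op_adj[OF W(1)]]] by simp
qed

section \<open>Depolarized projectors\<close>

text \<open>The depolarizing map \<open>A \<mapsto> \<alpha> A + (1 - \<alpha>) tr A / d\<close>, restricted to operators of unit trace.\<close>

definition depolarize :: "nat \<Rightarrow> real \<Rightarrow> complex mat \<Rightarrow> complex mat" where
  "depolarize d \<alpha> A = complex_of_real \<alpha> \<cdot>\<^sub>m A + complex_of_real ((1 - \<alpha>) / real d) \<cdot>\<^sub>m 1\<^sub>m d"

lemma depolarize_carrier [simp]: "A \<in> carrier_mat d d \<Longrightarrow> depolarize d \<alpha> A \<in> carrier_mat d d"
  by (simp add: depolarize_def)

lemma unitary_conj_depolarize:
  assumes "unitary_op d U" "A \<in> carrier_mat d d"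
  shows "unitary_conj U (depolarize d \<alpha> A) = depolarize d \<alpha> (unitary_conj U A)"
proof -
  have "U \<in> carrier_mat d d" "U * adj U = 1\<^sub>m d"
    using assms(1) by (simp_all add: unitary_op_def)
  then show ?thesis
    using assms(2) by (simp add: unitary_conj_def depolarize_def square_mat_simps[where n = d])
qed

lemma tr_depolarize_mult_depolarize:
  assumes d: "0 < d" and A: "A \<in> carrier_mat d d" "tr A = 1" and B: "B \<in> carrier_mat d d" "tr B = 1"
  shows "tr (depolarize d \<alpha> A * depolarize d \<beta> B)
    = of_real (\<alpha> * \<beta>) * tr (A * B) + of_real ((1 - \<alpha> * \<beta>) / real d)"
proof -
  define a b where "a = complex_of_real ((1 - \<alpha>) / real d)"
    and "b = complex_of_real ((1 - \<beta>) / real d)"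
  have "tr (depolarize d \<alpha> A * depolarize d \<beta> B)
      = of_real \<alpha> * of_real \<beta> * tr (A * B) + (of_real \<alpha> * b + a * of_real \<beta> + a * b * of_nat d)"
    using A B unfolding depolarize_def a_def[symmetric] b_def[symmetric]
    by (simp add: square_mat_simps[where n = d] algebra_simps)
  also have "of_real \<alpha> * b + a * of_real \<beta> + a * b * of_nat d = of_real ((1 - \<alpha> * \<beta>) / real d)"
    using d by (simp add: a_def b_def field_simps)
  finally show ?thesis by simp
qed

lemma depolarize_eqI:
  assumes d: "0 < d" and P: "P \<in> carrier_mat d d" "tr P = 1"
    and A: "A = complex_of_real a \<cdot>\<^sub>m P + complex_of_real b \<cdot>\<^sub>m 1\<^sub>m d" "tr A = 1"
  shows "A = depolarize d a P"
proof -
  have "complex_of_real (a + b * real d) = of_real 1"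
    using A P by (simp add: tr_add[of _ d] tr_smult[of _ d])
  then have "b = (1 - a) / real d"
    unfolding of_real_eq_iff using d by (simp add: field_simps)
  then show ?thesis by (simp add: A(1) depolarize_def)
qed

lemma depolarize_rank_one_projector_purity:
  assumes d: "2 \<le> d" and P: "rank_one_projector d P"
    and purity: "tr (depolarize d \<alpha> P * depolarize d \<alpha> P) = of_nat d"
  shows "\<alpha>\<^sup>2 = real d + 1"
proof -
  have "complex_of_real (\<alpha> * \<alpha> + (1 - \<alpha> * \<alpha>) / real d) = of_real (real d)"
    using purity d tr_depolarize_mult_depolarize[of d P P \<alpha> \<alpha>] P
    by (simp add: rank_one_projector_carrier tr_rank_one_projector rank_one_projector_tr_square)
  then have "(real d - 1) * (\<alpha>\<^sup>2 - (real d + 1)) = 0"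
    unfolding of_real_eq_iff using d by (simp add: field_simps power2_eq_square)
  then show ?thesis using d by simp
qed

lemma depolarize_qubit_complement:
  assumes "rank_one_projector 2 P"
  shows "\<exists>R. rank_one_projector 2 R \<and> depolarize 2 \<alpha> P = depolarize 2 (- \<alpha>) R"
proof -
  obtain v where v: "v \<in> carrier_vec 2" "P = ket_bra v" "tr P = 1"
    using assms unfolding rank_one_projector_iff_ket_bra by blast
  define w where "w = vec 2 (\<lambda>i. if i = 0 then - cnj (v $ 1) else cnj (v $ 0))"
  have w: "w \<in> carrier_vec 2" "w $ 0 = - cnj (v $ 1)" "w $ 1 = cnj (v $ 0)"
    by (simp_all add: w_def)
  have unit: "v $ 0 * cnj (v $ 0) + v $ 1 * cnj (v $ 1) = 1"
    using v by (simp add: tr_ket_bra numeral_2_eq_2)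
  then have "tr (ket_bra w) = 1"
    using w by (simp add: tr_ket_bra numeral_2_eq_2 algebra_simps)
  then have R: "rank_one_projector 2 (ket_bra w)"
    unfolding rank_one_projector_iff_ket_bra using w(1) by blast
  have "ket_bra w = 1\<^sub>m 2 - P"
    using v(1) w unit
    by (intro eq_matI) (auto simp: v(2) ket_bra_def less_2_cases_iff algebra_simps)
  then have "depolarize 2 \<alpha> P = depolarize 2 (- \<alpha>) (ket_bra w)"
    using rank_one_projector_carrier[OF assms]
    by (intro eq_matI) (auto simp: depolarize_def field_simps)
  with R show ?thesis by blast
qed

lemma hermitian_op_minimal_overlap_imp_affine_projector:
  assumes d: "2 \<le> d" and A: "hermitian_op d A"
    and lower: "\<And>U. unitary_op d U \<Longrightarrow>
      spectral_offdiag_mean d A \<le> Re (tr (A * unitary_conj U A))"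
  obtains P a b where "rank_one_projector d P"
    "A = complex_of_real a \<cdot>\<^sub>m P + complex_of_real b \<cdot>\<^sub>m 1\<^sub>m d"
proof -
  obtain V l m b where V: "unitary_op d V"
      "A = unitary_conj V (mat_diag d (\<lambda>i. complex_of_real (l i)))"
    and m: "m < d" "\<And>i. i < d \<Longrightarrow> i \<noteq> m \<Longrightarrow> l i = b"
    using overlap_ge_imp_constant_eigenvalues[OF d A lower] by blast
  let ?E = "ket_bra (unit_vec d m)"
  have "mat_diag d (\<lambda>i. complex_of_real (l i)) = of_real (l m - b) \<cdot>\<^sub>m ?E + of_real b \<cdot>\<^sub>m 1\<^sub>m d"
    using m by (intro eq_matI) (auto simp: ket_bra_unit_vec mat_diag_def)
  then have "A = of_real (l m - b) \<cdot>\<^sub>m unitary_conj V ?E + of_real b \<cdot>\<^sub>m 1\<^sub>m d"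
    using V by (simp add: unitary_conj_def unitary_op_def square_mat_simps[where n = d]
        left_mult_one_mat[of _ d d])
  with rank_one_projector_unitary_conj[OF V(1) rank_one_projector_unit_vec[OF m(1)]]
  show ?thesis by (rule that)
qed

section \<open>Unitary negativity\<close>

lemma NQPRD:
  assumes "NQPR d Q" "j < d\<^sup>2"
  shows "hermitian_op d (Q j)" "tr (Q j) = 1" "tr (Q j * Q j) = of_nat d"
  using assms by (auto simp: NQPR_def)

lemma NQPR_carrier: "NQPR d Q \<Longrightarrow> j < d\<^sup>2 \<Longrightarrow> Q j \<in> carrier_mat d d"
  using NQPRD(1) by (auto simp: hermitian_op_def)

lemma NU_unitary_le_iff:
  assumes d: "0 < d" and Q: "NQPR d Q" and U: "unitary_op d U"
  shows "NU_unitary d Q U \<le> b \<longleftrightarrow>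
    (\<forall>j<d\<^sup>2. \<forall>k<d\<^sup>2. - b \<le> Re (tr (Q j * unitary_conj U (Q k))))"
proof -
  let ?S = "{UQ d Q U j k | j k. j < d\<^sup>2 \<and> k < d\<^sup>2}"
  have S: "?S = (\<lambda>(j,k). UQ d Q U j k) ` ({..<d\<^sup>2} \<times> {..<d\<^sup>2})" by auto
  have "NU_unitary d Q U \<le> b \<longleftrightarrow> - b / real d \<le> Min ?S"
    using d by (auto simp: NU_unitary_def field_simps)
  also have "\<dots> \<longleftrightarrow> (\<forall>x\<in>?S. - b / real d \<le> x)"
    by (rule Min_ge_iff) (use d in \<open>auto simp: S lessThan_empty_iff\<close>)
  also have "\<dots> \<longleftrightarrow> (\<forall>j<d\<^sup>2. \<forall>k<d\<^sup>2. - b / real d \<le> UQ d Q U j k)" by blast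
  also have "\<dots> \<longleftrightarrow> (\<forall>j<d\<^sup>2. \<forall>k<d\<^sup>2. - b \<le> Re (tr (Q j * U * Q k * adj U)))"
    using d by (simp add: UQ_def divide_le_cancel del: divide_minus_left)
  also have "\<dots> \<longleftrightarrow> (\<forall>j<d\<^sup>2. \<forall>k<d\<^sup>2. - b \<le> Re (tr (Q j * unitary_conj U (Q k))))"
    using Q unitary_op_carrier[OF U]
    by (simp add: NQPR_carrier unitary_conj_def square_mat_simps[where n = d])
  finally show ?thesis .
qed

lemma NQPR_overlap_ge:
  assumes d: "0 < d" and Q: "NQPR d Q" and U: "unitary_op d U" and jk: "j < d\<^sup>2" "k < d\<^sup>2"
  shows "- (real d - 2 / real d) \<le> Re (tr (Q j * unitary_conj U (Q k)))"
proof -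
  note Qj = NQPRD[OF Q jk(1)] and Qk = NQPRD[OF Q jk(2)]
  note carriers = unitary_op_carrier[OF U] NQPR_carrier[OF Q jk(2)]
  let ?B = "unitary_conj U (Q k)"
  have "tr ?B = 1" "tr (?B * ?B) = of_nat d"
    using U carriers Qk(2,3)
    by (simp_all add: unitary_conj_mult tr_unitary_conj square_mat_simps[where n = d])
  with hermitian_op_tr_mult_ge[OF d Qj(1) hermitian_op_unitary_conj[OF carriers(1) Qk(1)]]
  show ?thesis using Qj(2,3) by simp
qed

lemma NU_le_iff:
  assumes d: "0 < d" and Q: "NQPR d Q"
  shows "NU d Q \<le> b \<longleftrightarrow>
    (\<forall>U. unitary_op d U \<longrightarrow> (\<forall>j<d\<^sup>2. \<forall>k<d\<^sup>2. - b \<le> Re (tr (Q j * unitary_conj U (Q k)))))"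
proof -
  let ?S = "{NU_unitary d Q U | U. unitary_op d U}"
  have "bdd_above ?S"
    using NQPR_overlap_ge[OF d Q]
    by (intro bdd_aboveI[of _ "real d - 2 / real d"]) (auto simp: NU_unitary_le_iff[OF d Q])
  moreover have "?S \<noteq> {}" using unitary_op_one by blast
  ultimately have "NU d Q \<le> b \<longleftrightarrow> (\<forall>x\<in>?S. x \<le> b)"
    unfolding NU_def by (intro cSup_le_iff)
  then show ?thesis using NU_unitary_le_iff[OF d Q] by auto
qed

lemma NQPR_spectral_offdiag_mean:
  assumes "2 \<le> d" "NQPR d Q" "j < d\<^sup>2"
  shows "spectral_offdiag_mean d (Q j) = - 1"
  using assms(1) NQPRD[OF assms(2,3)] by (simp add: spectral_offdiag_mean_def field_simps)

theorem NQPR_NU_ge_one: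
  assumes d: "2 \<le> d" and Q: "NQPR d Q"
  shows "1 \<le> NU d Q"
proof -
  have d_pos: "0 < d" "0 < d\<^sup>2" using d by auto
  obtain U where "unitary_op d U" "Re (tr (Q 0 * unitary_conj U (Q 0))) \<le> - 1"
    using exists_unitary_overlap_le[OF d NQPRD(1)[OF Q d_pos(2)]]
      NQPR_spectral_offdiag_mean[OF d Q d_pos(2)] by auto
  moreover have "- NU d Q \<le> Re (tr (Q 0 * unitary_conj U (Q 0)))" if "unitary_op d U" for U
    using NU_le_iff[OF d_pos(1) Q, of "NU d Q"] that d_pos(2) by blast
  ultimately show ?thesis by force
qed

theorem NQPR_NU_le:
  assumes "0 < d" "NQPR d Q"
  shows "NU d Q \<le> real d - 2 / real d"
  using NU_le_iff[OF assms] NQPR_overlap_ge[OF assms] by blast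

lemma NQPR_NU_le_one_depolarized_projector:
  assumes d: "2 \<le> d" and Q: "NQPR d Q" and negativity: "NU d Q \<le> 1" and j: "j < d\<^sup>2"
  shows "\<exists>P \<alpha>. rank_one_projector d P \<and> Q j = depolarize d \<alpha> P \<and> \<alpha>\<^sup>2 = real d + 1"
proof -
  have d_pos: "0 < d" using d by simp
  note Qj = NQPRD[OF Q j]
  have "spectral_offdiag_mean d (Q j) \<le> Re (tr (Q j * unitary_conj U (Q j)))"
    if "unitary_op d U" for U
    using NU_le_iff[OF d_pos Q, of 1] negativity j that
    unfolding NQPR_spectral_offdiag_mean[OF d Q j] by blast
  then obtain P a b where P: "rank_one_projector d P"
    and A: "Q j = complex_of_real a \<cdot>\<^sub>m P + complex_of_real b \<cdot>\<^sub>m 1\<^sub>m d"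
    using hermitian_op_minimal_overlap_imp_affine_projector[OF d Qj(1)] by blast
  have "Q j = depolarize d a P"
    by (rule depolarize_eqI[OF d_pos _ _ A Qj(2)])
       (use P in \<open>simp_all add: rank_one_projector_carrier tr_rank_one_projector\<close>)
  with P show ?thesis
    using depolarize_rank_one_projector_purity[OF d P] Qj(3) by auto
qed

lemma NQPR_NU_le_one_same_sign:
  assumes d: "2 < d" and Q: "NQPR d Q" and negativity: "NU d Q \<le> 1" and jk: "j < d\<^sup>2" "k < d\<^sup>2"
    and P: "rank_one_projector d P" "Q j = depolarize d \<alpha> P"
    and R: "rank_one_projector d R" "Q k = depolarize d \<beta> R"
    and squares: "\<alpha>\<^sup>2 = real d + 1" "\<beta>\<^sup>2 = real d + 1"
  shows "\<beta> = \<alpha>"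
proof (rule ccontr)
  assume "\<beta> \<noteq> \<alpha>"
  then have "\<alpha> * \<beta> = - (real d + 1)"
    using squares by (metis mult_minus_right power2_eq_iff power2_eq_square)
  obtain U where U: "unitary_op d U" "unitary_conj U R = P"
    by (rule rank_one_projectors_unitarily_equivalent[OF P(1) R(1)])
  have "unitary_conj U (Q k) = depolarize d \<beta> P"
    using unitary_conj_depolarize[OF U(1) rank_one_projector_carrier[OF R(1)]]
    by (simp add: R(2) U(2))
  then have "tr (Q j * unitary_conj U (Q k)) = of_real (\<alpha> * \<beta> + (1 - \<alpha> * \<beta>) / real d)"
    using d P by (simp add: tr_depolarize_mult_depolarize rank_one_projector_carrier
        tr_rank_one_projector rank_one_projector_tr_square)
  also have "\<alpha> * \<beta> + (1 - \<alpha> * \<beta>) / real d = 2 / real d - real d"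
    using d by (simp add: \<open>\<alpha> * \<beta> = - (real d + 1)\<close> field_simps)
  finally have "- 1 \<le> 2 / real d - real d"
    using NU_le_iff[of d Q 1] d Q negativity U(1) jk by force
  moreover have "2 / real d < 1" using d by simp
  ultimately show False using d by linarith
qed

definition depolarized_projectors ::
  "nat \<Rightarrow> real \<Rightarrow> (nat \<Rightarrow> complex mat) \<Rightarrow> (nat \<Rightarrow> complex mat) \<Rightarrow> bool" where
  "depolarized_projectors d \<alpha> P Q \<longleftrightarrow> \<alpha>\<^sup>2 = real d + 1 \<and>
     (\<forall>j<d\<^sup>2. rank_one_projector d (P j) \<and> Q j = depolarize d \<alpha> (P j))"

lemma NQPR_NU_le_one_imp_depolarized_projectors:
  assumes d: "2 \<le> d" and Q: "NQPR d Q" and negativity: "NU d Q \<le> 1"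
  shows "\<exists>P \<alpha>. depolarized_projectors d \<alpha> P Q"
proof -
  obtain P \<alpha> where P: "\<And>j. j < d\<^sup>2 \<Longrightarrow> rank_one_projector d (P j)"
    and QP: "\<And>j. j < d\<^sup>2 \<Longrightarrow> Q j = depolarize d (\<alpha> j) (P j)"
    and \<alpha>: "\<And>j. j < d\<^sup>2 \<Longrightarrow> (\<alpha> j)\<^sup>2 = real d + 1"
    using NQPR_NU_le_one_depolarized_projector[OF d Q negativity] by metis
  have d_pos: "0 < d\<^sup>2" using d by simp
  have "\<exists>R. rank_one_projector d R \<and> Q j = depolarize d (\<alpha> 0) R" if j: "j < d\<^sup>2" for j
  proof (cases "\<alpha> j = \<alpha> 0")
    case False
    then have flipped: "\<alpha> 0 = - \<alpha> j"
      using \<alpha>[OF j] \<alpha>[OF d_pos] by (metis power2_eq_iff minus_minus)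
    have "d = 2"
      using NQPR_NU_le_one_same_sign[OF _ Q negativity d_pos j
          P[OF d_pos] QP[OF d_pos] P[OF j] QP[OF j]]
        \<alpha>[OF d_pos] \<alpha>[OF j] False d by fastforce
    then show ?thesis
      using depolarize_qubit_complement[of "P j" "\<alpha> j"] P[OF j] QP[OF j] flipped by metis
  qed (use P QP j in metis)
  then show ?thesis unfolding depolarized_projectors_def using \<alpha>[OF d_pos] by metis
qed

lemma tr_depolarized_projectors_mult:
  assumes "0 < d" "rank_one_projector d P" "rank_one_projector d R" "\<alpha>\<^sup>2 = real d + 1"
  shows "tr (depolarize d \<alpha> P * depolarize d \<alpha> R) = of_real (real d + 1) * tr (P * R) - 1"
proof -
  have "tr (depolarize d \<alpha> P * depolarize d \<alpha> R)
      = of_real (\<alpha>\<^sup>2) * tr (P * R) + of_real ((1 - \<alpha>\<^sup>2) / real d)"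
    using assms(1-3) unfolding power2_eq_square
    by (intro tr_depolarize_mult_depolarize rank_one_projector_carrier tr_rank_one_projector)
  then show ?thesis using assms(1,4) by simp
qed

lemma depolarized_projectors_imp_NU_le_one:
  assumes d: "0 < d" and Q: "NQPR d Q" and P: "depolarized_projectors d \<alpha> P Q"
  shows "NU d Q \<le> 1"
  unfolding NU_le_iff[OF d Q]
proof (intro allI impI)
  fix U j k assume U: "unitary_op d U" and jk: "j < d\<^sup>2" "k < d\<^sup>2"
  have \<alpha>: "\<alpha>\<^sup>2 = real d + 1" and Pj: "rank_one_projector d (P j)" "Q j = depolarize d \<alpha> (P j)"
    and Pk: "rank_one_projector d (P k)" "Q k = depolarize d \<alpha> (P k)"
    using P jk by (auto simp: depolarized_projectors_def)
  let ?R = "unitary_conj U (P k)"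
  have R: "rank_one_projector d ?R" using rank_one_projector_unitary_conj[OF U Pk(1)] .
  have "unitary_conj U (Q k) = depolarize d \<alpha> ?R"
    using U Pk by (simp add: unitary_conj_depolarize rank_one_projector_carrier)
  then have "tr (Q j * unitary_conj U (Q k)) = of_real (real d + 1) * tr (P j * ?R) - 1"
    using tr_depolarized_projectors_mult[OF d Pj(1) R \<alpha>] Pj(2) by simp
  then show "- 1 \<le> Re (tr (Q j * unitary_conj U (Q k)))"
    using rank_one_projector_overlap_nonneg[OF Pj(1) R] by (simp del: of_real_add)
qed

lemma depolarized_projectors_imp_SIC:
  assumes d: "0 < d" and Q: "NQPR d Q" and P: "depolarized_projectors d \<alpha> P Q"
  shows "SIC d P"
  unfolding SIC_def
proof (intro conjI allI impI)
  fix j k assume jk: "j < d\<^sup>2" "k < d\<^sup>2"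
  have "tr (Q j * Q k) = of_real (real d + 1) * tr (P j * P k) - 1"
    using P jk d by (simp add: depolarized_projectors_def tr_depolarized_projectors_mult)
  then have "(of_nat d + 1) * tr (P j * P k) = of_nat d * (if j = k then 1 else 0) + 1"
    using Q jk by (auto simp: NQPR_def algebra_simps)
  moreover have "(of_nat d + 1 :: complex) \<noteq> 0"
    by (metis of_nat_Suc of_nat_eq_0_iff add.commute nat.distinct(1))
  ultimately show "tr (P j * P k) = (of_nat d * (if j = k then 1 else 0) + 1) / (of_nat d + 1)"
    by (simp add: field_simps)
qed (use P in \<open>simp add: depolarized_projectors_def\<close>)

lemma Qplus_eq_depolarize: "Qplus d P j = depolarize d (- sqrt (real d + 1)) (P j)"
  by (simp add: Qplus_def depolarize_def)

lemma Qminus_eq_depolarize: "Qminus d P j = depolarize d (sqrt (real d + 1)) (P j)"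
  by (simp add: Qminus_def depolarize_def)

lemma ex_SIC_Qminus_or_Qplus_iff_depolarized_projectors:
  assumes d: "0 < d" and Q: "NQPR d Q"
  shows "(\<exists>P. SIC d P \<and> ((\<forall>j<d\<^sup>2. Q j = Qminus d P j) \<or> (\<forall>j<d\<^sup>2. Q j = Qplus d P j))) \<longleftrightarrow>
    (\<exists>P \<alpha>. depolarized_projectors d \<alpha> P Q)"
    (is "(\<exists>P. ?sic P) \<longleftrightarrow> _")
proof
  assume "\<exists>P. ?sic P"
  then obtain P where P: "?sic P" by blast
  then have "depolarized_projectors d (sqrt (real d + 1)) P Q
      \<or> depolarized_projectors d (- sqrt (real d + 1)) P Q"
    by (auto simp: depolarized_projectors_def SIC_def Qminus_eq_depolarize Qplus_eq_depolarize)
  then show "\<exists>P \<alpha>. depolarized_projectors d \<alpha> P Q" by blast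
next
  assume "\<exists>P \<alpha>. depolarized_projectors d \<alpha> P Q"
  then obtain P \<alpha> where P: "depolarized_projectors d \<alpha> P Q" by blast
  then have "\<alpha>\<^sup>2 = (sqrt (real d + 1))\<^sup>2" by (simp add: depolarized_projectors_def)
  then have "\<alpha> = sqrt (real d + 1) \<or> \<alpha> = - sqrt (real d + 1)" by (rule power2_eq_iff[THEN iffD1])
  then show "\<exists>P. ?sic P"
    using depolarized_projectors_imp_SIC[OF d Q P] P
    by (auto simp: depolarized_projectors_def Qminus_eq_depolarize Qplus_eq_depolarize)
qed

theorem theorem3:
  fixes d :: nat and Q :: "nat \<Rightarrow> complex mat"
  assumes "d \<ge> 2" and "NQPR d Q"
  shows "1 \<le> NU d Q \<and> NU d Q \<le> real d - 2 / real d \<and>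
         (NU d Q = 1 \<longleftrightarrow>
            (\<exists>P. SIC d P \<and> ((\<forall>j < d^2. Q j = Qminus d P j) \<or> (\<forall>j < d^2. Q j = Qplus d P j))))"
proof -
  have d: "0 < d" using assms(1) by simp
  have lower: "1 \<le> NU d Q" by (rule NQPR_NU_ge_one[OF assms])
  have upper: "NU d Q \<le> real d - 2 / real d" by (rule NQPR_NU_le[OF d assms(2)])
  have "NU d Q = 1 \<longleftrightarrow> NU d Q \<le> 1" using lower by linarith
  also have "\<dots> \<longleftrightarrow> (\<exists>P \<alpha>. depolarized_projectors d \<alpha> P Q)"
    using NQPR_NU_le_one_imp_depolarized_projectors[OF assms]
      depolarized_projectors_imp_NU_le_one[OF d assms(2)] by blast
  finally show ?thesis
    using lower upper ex_SIC_Qminus_or_Qplus_iff_depolarized_projectors[OF d assms(2)] by simp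
qed

end
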